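(* For every $d\in\mathbb{N}$ let $(\mathcal{F}_d,\|\cdot\|_d)$ be a Banach space of measurable, integrable, real-valued functions on $[0,1]^d$, and let $e(0,d)$, $N_{\rm int}^{+}(\varepsilon,d)$ and $N_{\rm int}^{\rm qmc}(\varepsilon,d)$ be the initial error and the information complexities of integration in $\mathcal{F}_d$ as defined in the context. Assume that the following holds: 1. For all $d\in\mathbb{N}$ and all $f_1,\ldots,f_d\in\mathcal{F}_1$, the function $f(\boldsymbol{x})=f_1(x_1)\cdots f_d(x_d)$ belongs to $\mathcal{F}_d$ and satisfies $\|f\|_d\le\|f_1\|_1\cdots\|f_d\|_1$. 2. $e(0,d)=e(0,1)^d$ for all $d\in\mathbb{N}$. 3. There exists a non-negative function $h\in\mathcal{F}_1$ (with $\|h\|_1\neq 0$) such that $I(h/\|h\|_1)=e(0,1)$. 4. For every $y\in[0,1]$ there exists a function $s_y\in\mathcal{F}_1$ such that $s_y\ge 0$, $s_y(y)=h(y)$, and $$A:=\inf_{y\in[0,1]}\frac{I(h)}{I(s_y)}>1\quad\text{and}\quad B:=\inf_{y\in[0,1]}\frac{\|h\|_1}{\|s_y\|_1}>1 .$$ Then for every $d\in\mathbb{N}$ and every $\varepsilon\in(0,\tfrac12]$ we have $$N_{\rm int}^{+}(\varepsilon,d)\ \ge\ C^d\,(1-2\varepsilon),\qquad\text{where } C:=\min(A,B)>1 .$$ In particular, the integration problem suffers from the curse of dimensionality for non-negative weights, and especially for QMC weights; that is, for each $\bullet\in\{+,{\rm qmc}\}$ there exist a fixed $\varepsilon>0$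 and a real $C'>1$ such that $N_{\rm int}^{\bullet}(\varepsilon,d)\ge (C')^d$ for infinitely many $d\in\mathbb{N}$.
   Context: Elements of $\mathcal{F}_d$ are genuine functions, so point evaluation $f(\boldsymbol{x})$ is meaningful for every $\boldsymbol{x}\in[0,1]^d$. Write $I(f):=\int_{[0,1]^d}f(\boldsymbol{x})\,{\rm d}\boldsymbol{x}$ for $f\in\mathcal{F}_d$ (for any $d$). For an $N$-element point set $\mathcal{P}=\{\boldsymbol{x}_1,\ldots,\boldsymbol{x}_N\}\subset[0,1)^d$ and real weights $\mathcal{A}=\{a_1,\ldots,a_N\}$ (with $a_k$ attached to $\boldsymbol{x}_k$) put $Q_{\mathcal{P},\mathcal{A}}(f):=\sum_{k=1}^N a_k f(\boldsymbol{x}_k)$. The worst-case error is $$e(Q_{\mathcal{P},\mathcal{A}};\mathcal{F}_d):=\sup_{f\in\mathcal{F}_d,\ \|f\|_d\le 1}|I(f)-Q_{\mathcal{P},\mathcal{A}}(f)|,$$ and the initial error is $e(0,d):=\sup_{f\in\mathcal{F}_d,\ \|f\|_d\le1}|I(f)|$. For $N\in\mathbb{N}=\{1,2,\ldots\}$ define $e^{+}(N,d)$ as the infimum of $e(Q_{\mathcal{P},\mathcal{A}};\mathcal{F}_d)$ over all $N$-element sets $\mathcal{P}\subset[0,1)^d$ and all weights with $a_k\ge0$ for all $k$, and $e^{\rm qmc}(N,d)$ as the infimum over all $N$-element sets $\mathcal{P}\subset[0,1)^d$ with the fixed QMC weights $a_1=\cdots=a_N=1/N$. For $\bullet\in\{+,{\rm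 qmc}\}$, $\varepsilon\in(0,1)$, $d\in\mathbb{N}$, the information complexity is $$N_{\rm int}^{\bullet}(\varepsilon,d):=\min\{N\in\mathbb{N}:\ e^{\bullet}(N,d)\le\varepsilon\,e(0,d)\}$$ (with $\min\emptyset=\infty$). The quotients in assumption 4 are assumed to be meaningful, with the convention $c/0=+\infty$ for $c>0$ (and $0/0$ not allowed; in particular $I(h)>0$). *)

theory Defs
  imports "HOL-Analysis.Analysis"
begin

text \<open>
  Points of \<open>[0,1]\<^sup>d\<close> are extensional functions on \<open>{..<d}\<close>, so that \<open>d\<close> can vary
  inside a statement; the coordinate written \<open>x\<^sub>j\<close> in the mathematics is \<open>x (j - 1)\<close>.
\<close>

definition cube :: "nat \<Rightarrow> (nat \<Rightarrow> real) set" where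
  "cube d = ({..<d} \<rightarrow>\<^sub>E {0..1})"

definition half_open_cube :: "nat \<Rightarrow> (nat \<Rightarrow> real) set" where
  "half_open_cube d = ({..<d} \<rightarrow>\<^sub>E {0..<1})"

text \<open>The identification of \<open>[0,1]\<close> with \<open>[0,1]\<^sup>1\<close>.\<close>

definition point1 :: "real \<Rightarrow> nat \<Rightarrow> real" where
  "point1 y = (\<lambda>i\<in>{..<1}. y)"

text \<open>
  Lebesgue measure on \<open>[0,1]\<^sup>d\<close>. Because of the completion, measurability with respect to
  it is Lebesgue (not only Borel) measurability.
\<close>

definition cube_measure :: "nat \<Rightarrow> (nat \<Rightarrow> real) measure" where
  "cube_measure d = completion (Pi\<^sub>M {..<d} (\<lambda>_. restrict_space lborel {0..1}))"

lemma space_cube_measure: "space (cube_measure d) = cube d"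
  by (simp add: cube_measure_def cube_def space_PiM space_restrict_space)

definition I :: "nat \<Rightarrow> ((nat \<Rightarrow> real) \<Rightarrow> real) \<Rightarrow> real" where
  "I d f = (LINT x|cube_measure d. f x)"

text \<open>
  A function on \<open>[0,1]\<^sup>d\<close> is represented by its extension by zero. This makes
  representatives unique, and the representation is compatible with pointwise linear operations.
\<close>

definition banach_function_space ::
  "nat \<Rightarrow> ((nat \<Rightarrow> real) \<Rightarrow> real) set \<Rightarrow> (((nat \<Rightarrow> real) \<Rightarrow> real) \<Rightarrow> real) \<Rightarrow> bool" where
  "banach_function_space d V nrm \<longleftrightarrow>
     (\<forall>f\<in>V. integrable (cube_measure d) f \<and> (\<forall>x. x \<notin> cube d \<longrightarrow> f x = 0)) \<and>
     (\<lambda>_. 0) \<in> V \<and>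
     (\<forall>f\<in>V. \<forall>g\<in>V. (\<lambda>x. f x + g x) \<in> V) \<and>
     (\<forall>c. \<forall>f\<in>V. (\<lambda>x. c * f x) \<in> V) \<and>
     (\<forall>f\<in>V. nrm f \<ge> 0 \<and> (nrm f = 0 \<longleftrightarrow> f = (\<lambda>_. 0))) \<and>
     (\<forall>c. \<forall>f\<in>V. nrm (\<lambda>x. c * f x) = \<bar>c\<bar> * nrm f) \<and>
     (\<forall>f\<in>V. \<forall>g\<in>V. nrm (\<lambda>x. f x + g x) \<le> nrm f + nrm g) \<and>
     (\<forall>\<sigma>. (\<forall>n. \<sigma> n \<in> V) \<and>
          (\<forall>e>0. \<exists>M. \<forall>m\<ge>M. \<forall>n\<ge>M. nrm (\<lambda>x. \<sigma> m x - \<sigma> n x) < e) \<longrightarrow>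
          (\<exists>g\<in>V. (\<lambda>n. nrm (\<lambda>x. \<sigma> n x - g x)) \<longlonglongrightarrow> 0))"

definition tensor_product ::
  "nat \<Rightarrow> (nat \<Rightarrow> (nat \<Rightarrow> real) \<Rightarrow> real) \<Rightarrow> (nat \<Rightarrow> real) \<Rightarrow> real" where
  "tensor_product d f x = (if x \<in> cube d then \<Prod>i<d. f i (point1 (x i)) else 0)"

definition quadrature ::
  "(nat \<Rightarrow> real) set \<Rightarrow> ((nat \<Rightarrow> real) \<Rightarrow> real) \<Rightarrow> ((nat \<Rightarrow> real) \<Rightarrow> real) \<Rightarrow> real" where
  "quadrature P a f = (\<Sum>x\<in>P. a x * f x)"

text \<open>
  Errors are extended reals, since neither integration nor point evaluation is assumed to be
  bounded on the unit ball.
\<close>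

definition worst_case_error ::
  "nat \<Rightarrow> ((nat \<Rightarrow> real) \<Rightarrow> real) set \<Rightarrow> (((nat \<Rightarrow> real) \<Rightarrow> real) \<Rightarrow> real)
    \<Rightarrow> (nat \<Rightarrow> real) set \<Rightarrow> ((nat \<Rightarrow> real) \<Rightarrow> real) \<Rightarrow> ereal" where
  "worst_case_error d V nrm P a =
     (SUP f\<in>{f \<in> V. nrm f \<le> 1}. ereal \<bar>I d f - quadrature P a f\<bar>)"

definition initial_error ::
  "nat \<Rightarrow> ((nat \<Rightarrow> real) \<Rightarrow> real) set \<Rightarrow> (((nat \<Rightarrow> real) \<Rightarrow> real) \<Rightarrow> real) \<Rightarrow> ereal" where
  "initial_error d V nrm = (SUP f\<in>{f \<in> V. nrm f \<le> 1}. ereal \<bar>I d f\<bar>)"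

definition e_plus ::
  "nat \<Rightarrow> nat \<Rightarrow> ((nat \<Rightarrow> real) \<Rightarrow> real) set \<Rightarrow> (((nat \<Rightarrow> real) \<Rightarrow> real) \<Rightarrow> real) \<Rightarrow> ereal" where
  "e_plus N d V nrm =
     (INF (P, a)\<in>{(P, a). P \<subseteq> half_open_cube d \<and> finite P \<and> card P = N \<and> (\<forall>x\<in>P. a x \<ge> 0)}.
        worst_case_error d V nrm P a)"

definition e_qmc ::
  "nat \<Rightarrow> nat \<Rightarrow> ((nat \<Rightarrow> real) \<Rightarrow> real) set \<Rightarrow> (((nat \<Rightarrow> real) \<Rightarrow> real) \<Rightarrow> real) \<Rightarrow> ereal" where
  "e_qmc N d V nrm =
     (INF P\<in>{P. P \<subseteq> half_open_cube d \<and> finite P \<and> card P = N}.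
        worst_case_error d V nrm P (\<lambda>_. 1 / real N))"

text \<open>On \<open>enat\<close>, \<open>Inf\<close> is the minimum for nonempty sets and \<open>Inf {} = \<infinity>\<close>.\<close>

definition N_int_plus ::
  "(nat \<Rightarrow> ((nat \<Rightarrow> real) \<Rightarrow> real) set) \<Rightarrow> (nat \<Rightarrow> ((nat \<Rightarrow> real) \<Rightarrow> real) \<Rightarrow> real)
    \<Rightarrow> real \<Rightarrow> nat \<Rightarrow> enat" where
  "N_int_plus F nrm \<epsilon> d =
     Inf (enat ` {N. N \<ge> 1 \<and>
       e_plus N d (F d) (nrm d) \<le> ereal \<epsilon> * initial_error d (F d) (nrm d)})"

definition N_int_qmc ::
  "(nat \<Rightarrow> ((nat \<Rightarrow> real) \<Rightarrow> real) set) \<Rightarrow> (nat \<Rightarrow> ((nat \<Rightarrow> real) \<Rightarrow> real) \<Rightarrow> real)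
    \<Rightarrow> real \<Rightarrow> nat \<Rightarrow> enat" where
  "N_int_qmc F nrm \<epsilon> d =
     Inf (enat ` {N. N \<ge> 1 \<and>
       e_qmc N d (F d) (nrm d) \<le> ereal \<epsilon> * initial_error d (F d) (nrm d)})"

definition curse_of_dimensionality :: "(real \<Rightarrow> nat \<Rightarrow> enat) \<Rightarrow> bool" where
  "curse_of_dimensionality n \<longleftrightarrow>
     (\<exists>\<epsilon> C'. 0 < \<epsilon> \<and> \<epsilon> < 1 \<and> 1 < C' \<and>
        infinite {d. d \<ge> 1 \<and> ereal_of_enat (n \<epsilon> d) \<ge> ereal (C' ^ d)})"

end

theory Submission
  imports Defs "HOL-Probability.Probability"
begin

text \<open>
  Fix nodes \<open>x\<^sub>1, \<dots>, x\<^sub>N\<close> and non-negative weights. The extremal function is the normalised tensor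
  power \<open>f\<close> of \<open>h\<close>. Replacing, for each node \<open>x\<^sub>k\<close>, the \<open>j\<close>-th factor \<open>h\<close> by \<open>s\<^sub>y\<close> with
  \<open>y = x\<^sub>k\<^sub>j\<close> gives a function that agrees with \<open>f\<close> at \<open>x\<^sub>k\<close> but whose integral and norm are
  smaller by the factor \<open>C\<^sup>d\<close>. The sum \<open>g\<close> of these \<open>N\<close> non-negative functions dominates \<open>f\<close> at every
  node, so \<open>Q f \<le> Q g\<close>, whereas \<open>I g \<le> (N / C\<^sup>d) I f\<close>. If \<open>N \<le> C\<^sup>d\<close> then both \<open>f\<close> and \<open>g\<close> lie in
  the unit ball, and one of the two errors is at least \<open>(I f - I g) / 2\<close>.
\<close>

section \<open>The unit interval as a probability space, and coordinates of cube points\<close>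

abbreviation unit_interval :: "real measure" where
  "unit_interval \<equiv> restrict_space lborel {0..1}"

lemma prob_space_unit_interval: "prob_space unit_interval"
  by (rule prob_space_restrict_space) auto

lemma product_prob_space_unit_interval: "product_prob_space (\<lambda>_. unit_interval)"
  by (intro product_prob_spaceI prob_space_unit_interval)

lemma point1_coordinate: "x \<in> cube 1 \<Longrightarrow> point1 (x 0) = x"
  by (auto simp: cube_def point1_def fun_eq_iff PiE_iff extensional_def)

lemma point1_in_cube: "y \<in> {0..1} \<Longrightarrow> point1 y \<in> cube 1"
  by (auto simp: cube_def point1_def)

lemma coordinate_in_unit_interval: "x \<in> cube d \<Longrightarrow> i < d \<Longrightarrow> x i \<in> {0..1}"
  using PiE_mem[of x "{..<d}" "\<lambda>_. {0..1}" i] by (simp add: cube_def)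

lemma point1_coordinate_in_cube: "x \<in> cube d \<Longrightarrow> i < d \<Longrightarrow> point1 (x i) \<in> cube 1"
  by (rule point1_in_cube[OF coordinate_in_unit_interval[of x d i]])

lemma half_open_cube_subset: "half_open_cube d \<subseteq> cube d"
  unfolding half_open_cube_def cube_def by (rule PiE_mono) auto

subsection \<open>Integrals of tensor products\<close>

lemma measurable_point1: "point1 \<in> unit_interval \<rightarrow>\<^sub>M Pi\<^sub>M {..<1} (\<lambda>_. unit_interval)"
  unfolding point1_def by (rule measurable_restrict) simp

text \<open>The coordinate map \<open>x 0\<close> carries the one-factor product measure to Lebesgue
  measure on the interval, and \<open>point1\<close> inverts it on the cube. Null sets therefore
  correspond under the identification of the two spaces.\<close>

lemma AE_point1:
  assumes "AE x in Pi\<^sub>M {..<1} (\<lambda>_. unit_interval). P x"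
  shows "AE y in unit_interval. P (point1 y)"
proof -
  interpret product_prob_space "\<lambda>_. unit_interval" "{..<1::nat}"
    by (rule product_prob_space_unit_interval)
  let ?M = "Pi\<^sub>M {..<1::nat} (\<lambda>_. unit_interval)"
  have space: "space ?M = cube 1"
    by (simp add: space_PiM cube_def space_restrict_space)
  \<comment> \<open>The exceptional set itself need not be measurable, so it is enclosed in a
    measurable null set before being pulled back.\<close>
  obtain N where N: "N \<in> null_sets ?M" "{x \<in> space ?M. \<not> P x} \<subseteq> N"
    using assms by (auto simp: eventually_ae_filter)
  have [measurable]: "N \<in> sets ?M" using N(1) by auto
  note [measurable] = measurable_point1
  have distr: "distr ?M unit_interval (\<lambda>x. x 0) = unit_interval"
    using distr_singleton[of 0] by (simp add: lessThan_Suc)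
  have comp [measurable]: "(\<lambda>x. x 0) \<in> ?M \<rightarrow>\<^sub>M unit_interval"
    by (rule measurable_component_singleton) simp
  have meas: "{y \<in> space unit_interval. point1 y \<notin> N} \<in> sets unit_interval"
    by measurable
  have "AE x in ?M. point1 (x 0) \<notin> N"
    using AE_not_in[OF N(1)] by (rule AE_mp) (auto simp: space point1_coordinate simp del: One_nat_def intro!: AE_I2)
  then have "AE y in distr ?M unit_interval (\<lambda>x. x 0). point1 y \<notin> N"
    by (subst AE_distr_iff[OF comp meas])
  then have "AE y in unit_interval. point1 y \<notin> N"
    by (simp only: distr)
  moreover have "P (point1 y)" if "y \<in> space unit_interval" "point1 y \<notin> N" for y
    using N(2) point1_in_cube[of y] that by (auto simp: space space_restrict_space simp del: One_nat_def)
  ultimately show ?thesis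
    by (auto elim: AE_mp)
qed

text \<open>Members of the function spaces are only measurable for the completed measure, while
  Fubini is applied to factors measurable on the uncompleted interval. This supplies such a factor,
  equal almost everywhere and with the same integral.\<close>

lemma borel_representative:
  assumes "integrable (cube_measure 1) f"
  obtains \<phi> where "integrable unit_interval \<phi>" "AE y in unit_interval. f (point1 y) = \<phi> y"
    "I 1 f = integral\<^sup>L unit_interval \<phi>"
proof -
  interpret product_prob_space "\<lambda>_. unit_interval" "{..<1::nat}"
    by (rule product_prob_space_unit_interval)
  let ?M = "Pi\<^sub>M {..<1::nat} (\<lambda>_. unit_interval)"
  have f: "f \<in> borel_measurable (completion ?M)"
    using assms by (auto simp: cube_measure_def)
  obtain g where g: "g \<in> borel_measurable ?M" "AE x in ?M. f x = g x"
    using completion_ex_borel_measurable_real[OF f] by auto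
  have gc: "g \<in> borel_measurable (completion ?M)"
    by (rule measurable_completion[OF g(1)])
  define \<phi> where "\<phi> y = g (point1 y)" for y
  have \<phi>: "\<phi> \<in> borel_measurable unit_interval"
    unfolding \<phi>_def by (rule measurable_compose[OF measurable_point1 g(1)])
  have g_eq: "g x = \<phi> (x 0)" if "x \<in> space ?M" for x
    using point1_coordinate[of x] that
    by (simp add: \<phi>_def cube_def space_PiM space_restrict_space)
  have distr: "distr ?M unit_interval (\<lambda>x. x 0) = unit_interval"
    using distr_singleton[of 0] by (simp add: lessThan_Suc)
  have comp: "(\<lambda>x. x 0) \<in> ?M \<rightarrow>\<^sub>M unit_interval"
    by (rule measurable_component_singleton) simp
  have ae: "AE x in completion ?M. f x = g x"
    using g(2) by (rule AE_completion)
  have "integrable (completion ?M) g"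
    using assms integrable_cong_AE[OF f gc ae] by (simp add: cube_measure_def)
  then have "integrable ?M g"
    using integrable_completion[OF g(1)] by simp
  then have "integrable ?M (\<lambda>x. \<phi> (x 0))"
    by (subst Bochner_Integration.integrable_cong[OF refl g_eq[symmetric]])
  then have int: "integrable unit_interval \<phi>"
    using integrable_distr_eq[OF comp, of \<phi>] \<phi> by (simp add: distr del: One_nat_def)
  have "I 1 f = integral\<^sup>L (completion ?M) g"
    unfolding I_def cube_measure_def by (rule integral_cong_AE[OF f gc ae])
  also have "\<dots> = integral\<^sup>L ?M g"
    by (rule integral_completion[OF g(1)])
  also have "\<dots> = (LINT x|?M. \<phi> (x 0))"
    by (rule Bochner_Integration.integral_cong[OF refl g_eq])
  also have "\<dots> = integral\<^sup>L unit_interval \<phi>"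
    using integral_distr[OF comp, of \<phi>] \<phi> by (simp add: distr del: One_nat_def)
  finally have "I 1 f = integral\<^sup>L unit_interval \<phi>" .
  moreover have "AE y in unit_interval. f (point1 y) = \<phi> y"
    unfolding \<phi>_def by (rule AE_point1[OF g(2)])
  ultimately show ?thesis using that int by blast
qed

text \<open>The preimages of a set under \<open>f\<close> and \<open>g\<close> differ only by a null
  set, and the completion contains every set that agrees almost everywhere with one of its own. This
  is how a tensor product of merely Lebesgue measurable factors is seen to be measurable.\<close>

lemma borel_measurable_completion_AE:
  assumes f: "f \<in> borel_measurable (completion M)" and ae: "AE x in completion M. f x = g x"
  shows "g \<in> borel_measurable (completion M)"
proof (rule measurableI)
  fix A :: "'b set" assume "A \<in> sets borel"
  then have "f -` A \<inter> space (completion M) \<in> sets (completion M)"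
    by (rule measurable_sets[OF f])
  moreover have "AE x in completion M. x \<in> f -` A \<inter> space (completion M)
      \<longleftrightarrow> x \<in> g -` A \<inter> space (completion M)"
    using ae by eventually_elim auto
  ultimately show "g -` A \<inter> space (completion M) \<in> sets (completion M)"
    using completion.in_sets_AE by blast
qed simp

text \<open>Fubini for the Borel representatives of the factors, transferred back along almost
  everywhere equality.\<close>

lemma I_tensor_product:
  assumes "\<And>i. i < d \<Longrightarrow> integrable (cube_measure 1) (f i)"
  shows "I d (tensor_product d f) = (\<Prod>i<d. I 1 (f i))"
proof -
  interpret product_prob_space "\<lambda>_. unit_interval" "{..<d}"
    by (rule product_prob_space_unit_interval)
  let ?M = "Pi\<^sub>M {..<d} (\<lambda>_. unit_interval)"
  have space: "space ?M = cube d"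
    by (simp add: space_PiM cube_def space_restrict_space)
  have "\<exists>\<phi>. integrable unit_interval \<phi> \<and> (AE y in unit_interval. f i (point1 y) = \<phi> y)
      \<and> I 1 (f i) = integral\<^sup>L unit_interval \<phi>" if "i < d" for i
    using borel_representative[OF assms[OF that]] by blast
  then obtain \<phi> where \<phi>: "\<And>i. i < d \<Longrightarrow> integrable unit_interval (\<phi> i)"
      "\<And>i. i < d \<Longrightarrow> AE y in unit_interval. f i (point1 y) = \<phi> i y"
      "\<And>i. i < d \<Longrightarrow> I 1 (f i) = integral\<^sup>L unit_interval (\<phi> i)"
    by metis
  let ?g = "\<lambda>x. \<Prod>i<d. \<phi> i (x i)"
  have g: "?g \<in> borel_measurable ?M"
  proof (rule borel_measurable_prod)
    fix i assume i: "i \<in> {..<d}"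
    then have "\<phi> i \<in> borel_measurable unit_interval" using \<phi>(1) by auto
    with i show "(\<lambda>x. \<phi> i (x i)) \<in> borel_measurable ?M"
      by (intro measurable_compose[OF measurable_component_singleton])
  qed
  \<comment> \<open>The exceptional set of one factor lifts to a null cylinder in the product;
    finitely many such cylinders still form a null set.\<close>
  have "AE x in ?M. f i (point1 (x i)) = \<phi> i (x i)" if "i \<in> {..<d}" for i
    using AE_component[OF that] \<phi>(2) that by auto
  then have "AE x in ?M. \<forall>i\<in>{..<d}. f i (point1 (x i)) = \<phi> i (x i)"
    by (intro AE_finite_allI) auto
  then have "AE x in ?M. ?g x = tensor_product d f x"
    by (rule AE_mp) (auto simp: space tensor_product_def intro!: AE_I2 prod.cong)
  then have ae: "AE x in completion ?M. ?g x = tensor_product d f x"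
    by (rule AE_completion)
  have gc: "?g \<in> borel_measurable (completion ?M)"
    by (rule measurable_completion[OF g])
  have tc: "tensor_product d f \<in> borel_measurable (completion ?M)"
    by (rule borel_measurable_completion_AE[OF gc ae])
  have "I d (tensor_product d f) = integral\<^sup>L (completion ?M) ?g"
    unfolding I_def cube_measure_def using ae
    by (intro integral_cong_AE[OF tc gc]) auto
  also have "\<dots> = integral\<^sup>L ?M ?g"
    by (rule integral_completion[OF g])
  also have "\<dots> = (\<Prod>i<d. integral\<^sup>L unit_interval (\<phi> i))"
    by (rule product_integral_prod) (auto simp: \<phi>)
  finally show ?thesis by (simp add: \<phi>(3) del: One_nat_def)
qed

subsection \<open>Lower bounds for the worst-case error\<close>

lemma banach_function_spaceD:
  assumes "banach_function_space d V nrm"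
  shows "f \<in> V \<Longrightarrow> integrable (cube_measure d) f"
    and "(\<lambda>_. 0) \<in> V"
    and "f \<in> V \<Longrightarrow> g \<in> V \<Longrightarrow> (\<lambda>x. f x + g x) \<in> V"
    and "f \<in> V \<Longrightarrow> (\<lambda>x. c * f x) \<in> V"
    and "f \<in> V \<Longrightarrow> 0 \<le> nrm f"
    and "f \<in> V \<Longrightarrow> nrm f = 0 \<longleftrightarrow> f = (\<lambda>_. 0)"
    and "f \<in> V \<Longrightarrow> nrm (\<lambda>x. c * f x) = \<bar>c\<bar> * nrm f"
    and "f \<in> V \<Longrightarrow> g \<in> V \<Longrightarrow> nrm (\<lambda>x. f x + g x) \<le> nrm f + nrm g"
  using assms unfolding banach_function_space_def by (elim conjE, simp)+

lemma banach_function_space_sum: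
  assumes V: "banach_function_space d V nrm" and "\<And>k. k \<in> K \<Longrightarrow> f k \<in> V"
  shows "(\<lambda>x. \<Sum>k\<in>K. f k x) \<in> V \<and> nrm (\<lambda>x. \<Sum>k\<in>K. f k x) \<le> (\<Sum>k\<in>K. nrm (f k))"
  using assms(2)
proof (induction K rule: infinite_finite_induct)
  case (insert k K)
  let ?S = "\<lambda>x. \<Sum>k\<in>K. f k x"
  have S: "?S \<in> V" "nrm ?S \<le> (\<Sum>k\<in>K. nrm (f k))" and k: "f k \<in> V"
    using insert by auto
  have "(\<lambda>x. f k x + ?S x) \<in> V" "nrm (\<lambda>x. f k x + ?S x) \<le> nrm (f k) + nrm ?S"
    by (rule banach_function_spaceD(3)[OF V k S(1)], rule banach_function_spaceD(8)[OF V k S(1)])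
  with S(2) insert.hyps show ?case by simp
\<comment> \<open>Sums over empty or infinite index sets are the zero function, which has norm
  0.\<close>
qed (use banach_function_spaceD(2)[OF V] banach_function_spaceD(6)[OF V, of "\<lambda>_. 0"] in simp_all)

lemma worst_case_error_ge:
  assumes "f \<in> V" "nrm f \<le> 1"
  shows "ereal \<bar>I d f - quadrature P a f\<bar> \<le> worst_case_error d V nrm P a"
  unfolding worst_case_error_def using assms by (intro SUP_upper) auto

text \<open>If both errors were below half the gap, \<open>Q f\<close> would lie above the midpoint
  of \<open>I f\<close> and \<open>I g\<close>, and \<open>Q g\<close> below it, contradicting
  \<open>Q f <= Q g\<close>.\<close>

lemma worst_case_error_ge_half_diff:
  assumes "f \<in> V" "nrm f \<le> 1" "g \<in> V" "nrm g \<le> 1"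
    and "quadrature P a f \<le> quadrature P a g"
  shows "ereal ((I d f - I d g) / 2) \<le> worst_case_error d V nrm P a"
proof -
  have "(I d f - I d g) / 2 \<le> \<bar>I d f - quadrature P a f\<bar> \<or>
        (I d f - I d g) / 2 \<le> \<bar>I d g - quadrature P a g\<bar>"
  proof (cases "(I d f - I d g) / 2 \<le> \<bar>I d f - quadrature P a f\<bar>")
    case False
    then have "(I d f - I d g) / 2 \<le> \<bar>I d g - quadrature P a g\<bar>"
      using assms(5) abs_ge_self[of "I d f - quadrature P a f"]
        abs_ge_minus_self[of "I d g - quadrature P a g"] by argo
    then show ?thesis ..
  qed simp
  then show ?thesis
    using worst_case_error_ge[of f V nrm d P a] worst_case_error_ge[of g V nrm d P a] assms
    by (metis ereal_less_eq(3) order_trans)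
qed

lemma worst_case_error_nonneg:
  assumes "banach_function_space d V nrm"
  shows "0 \<le> worst_case_error d V nrm P a"
proof -
  have "(\<lambda>_. 0) \<in> V" "nrm (\<lambda>_. 0) \<le> 1"
    using banach_function_spaceD(2)[OF assms] banach_function_spaceD(6)[OF assms, of "\<lambda>_. 0"]
    by simp_all
  from worst_case_error_ge[of "\<lambda>_. 0" V nrm d P a, OF this] show ?thesis
    by (simp add: I_def quadrature_def zero_ereal_def)
qed

text \<open>The bound for one fixed rule, with a real constant \<open>c\<close> in place of
  \<open>C\<close> and bounds for each \<open>y\<close> in place of the infima. The leading factor
  is the integral of the normalised tensor power of \<open>h\<close>, up to its norm being possibly
  less than \<open>nrm1 h ^ d\<close>.\<close>

lemma worst_case_error_lower_bound:
  fixes c :: real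
  assumes V1: "banach_function_space 1 V1 nrm1" and V: "banach_function_space d V nrm"
    and tensor: "\<And>f. (\<And>i. i < d \<Longrightarrow> f i \<in> V1) \<Longrightarrow>
          tensor_product d f \<in> V \<and> nrm (tensor_product d f) \<le> (\<Prod>i<d. nrm1 (f i))"
    and h: "h \<in> V1" "nrm1 h > 0" "I 1 h \<ge> 0"
    and s: "\<And>y. y \<in> {0..1} \<Longrightarrow> s y \<in> V1"
      "\<And>y x. y \<in> {0..1} \<Longrightarrow> x \<in> cube 1 \<Longrightarrow> s y x \<ge> 0"
      "\<And>y. y \<in> {0..1} \<Longrightarrow> s y (point1 y) = h (point1 y)"
    and c: "c > 0" "\<And>y. y \<in> {0..1} \<Longrightarrow> I 1 (s y) \<le> I 1 h / c"
      "\<And>y. y \<in> {0..1} \<Longrightarrow> nrm1 (s y) \<le> nrm1 h / c"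
    and P: "P \<subseteq> cube d" "finite P" and a: "\<And>x. x \<in> P \<Longrightarrow> a x \<ge> 0"
  shows "ereal ((I 1 h / nrm1 h) ^ d * (1 - real (card P) / c ^ d) / 2)
    \<le> worst_case_error d V nrm P a"
\<comment> \<open>With more than \<open>c ^ d\<close> nodes the claimed bound is at most 0, so
  non-negativity of the error suffices.\<close>
proof (cases "real (card P) \<le> c ^ d")
  case False
  then have "1 - real (card P) / c ^ d \<le> 0"
    using c(1) by (simp add: field_simps)
  moreover have "(I 1 h / nrm1 h) ^ d \<ge> 0"
    using h by simp
  ultimately have "(I 1 h / nrm1 h) ^ d * (1 - real (card P) / c ^ d) / 2 \<le> 0"
    by (simp add: mult_nonneg_nonpos)
  then have "ereal ((I 1 h / nrm1 h) ^ d * (1 - real (card P) / c ^ d) / 2) \<le> 0"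
    by (simp only: ereal_less_eq)
  then show ?thesis
    using worst_case_error_nonneg[OF V] by (rule order_trans)
next
  case True
  define H where "H = nrm1 h"
  \<comment> \<open>\<open>t\<close> bounds the loss from \<open>hp\<close> to the sum
    \<open>gs\<close>, both in norm and in integral; \<open>t\<close> being at most 1 keeps
    \<open>gs\<close> in the unit ball after normalisation.\<close>
  define t where "t = real (card P) / c ^ d"
  have H: "H > 0" using h by (simp add: H_def)
  have t: "t \<le> 1" using True c(1) by (simp add: t_def)
  have integrable: "integrable (cube_measure 1) f" if "f \<in> V1" for f
    by (rule banach_function_spaceD(1)[OF V1 that])
  have integrable': "integrable (cube_measure d) f" if "f \<in> V" for f
    by (rule banach_function_spaceD(1)[OF V that])
  have scale: "(\<lambda>x. r * f x) \<in> V \<and> nrm (\<lambda>x. r * f x) = \<bar>r\<bar> * nrm f" if "f \<in> V" for r f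
    by (intro conjI banach_function_spaceD(4,7)[OF V that])
  have scale_I: "I d (\<lambda>x. r * f x) = r * I d f" for r f
    by (simp add: I_def)
  have scale_Q: "quadrature P a (\<lambda>x. r * f x) = r * quadrature P a f" for r f
    by (simp add: quadrature_def sum_distrib_left mult.left_commute)
  have cube: "x i \<in> {0..1}" if "x \<in> P" "i < d" for x i
    using coordinate_in_unit_interval that P(1) by blast

  define hp where "hp = tensor_product d (\<lambda>_. h)"
  \<comment> \<open>The node \<open>k\<close> is its own index: its coordinate \<open>k i\<close>
    selects the replacement for the \<open>i\<close>-th factor.\<close>
  define gk where "gk k = tensor_product d (\<lambda>i. s (k i))" for k
  define gs where "gs x = (\<Sum>k\<in>P. gk k x)" for x
  have hp: "hp \<in> V" "nrm hp \<le> H ^ d" "I d hp = I 1 h ^ d"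
    using tensor[of "\<lambda>_. h"] I_tensor_product[of d "\<lambda>_. h"] integrable[OF h(1)] h(1)
    by (auto simp: hp_def H_def)
  \<comment> \<open>Factorwise upper bounds can be multiplied because the norms and integrals of the
    \<open>s y\<close> are non-negative.\<close>
  have s_norm_nonneg: "0 \<le> nrm1 (s y)" if "y \<in> {0..1}" for y
    by (rule banach_function_spaceD(5)[OF V1 s(1)[OF that]])
  have s_int_nonneg: "0 \<le> I 1 (s y)" if "y \<in> {0..1}" for y
    unfolding I_def
    by (rule Bochner_Integration.integral_nonneg) (use s(2)[OF that] in \<open>simp add: space_cube_measure\<close>)
  have gk: "gk k \<in> V" "nrm (gk k) \<le> (H / c) ^ d" "I d (gk k) \<le> (I 1 h / c) ^ d"
    if "k \<in> P" for k
  proof -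
    have "gk k \<in> V \<and> nrm (gk k) \<le> (\<Prod>i<d. nrm1 (s (k i)))"
      unfolding gk_def by (intro tensor s(1) cube[OF that])
    moreover have "(\<Prod>i<d. nrm1 (s (k i))) \<le> (\<Prod>i<d. H / c)"
    proof (rule prod_mono)
      fix i assume "i \<in> {..<d}"
      then have "k i \<in> {0..1}" using cube[OF that] by blast
      then show "0 \<le> nrm1 (s (k i)) \<and> nrm1 (s (k i)) \<le> H / c"
        unfolding H_def by (intro conjI s_norm_nonneg c(3))
    qed
    ultimately show "gk k \<in> V" "nrm (gk k) \<le> (H / c) ^ d" by auto
    have "I d (gk k) = (\<Prod>i<d. I 1 (s (k i)))"
      unfolding gk_def by (intro I_tensor_product integrable s(1) cube[OF that])
    also have "\<dots> \<le> (\<Prod>i<d. I 1 h / c)"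
    proof (rule prod_mono)
      fix i assume "i \<in> {..<d}"
      then have "k i \<in> {0..1}" using cube[OF that] by blast
      then show "0 \<le> I 1 (s (k i)) \<and> I 1 (s (k i)) \<le> I 1 h / c"
        by (intro conjI s_int_nonneg c(2))
    qed
    finally show "I d (gk k) \<le> (I 1 h / c) ^ d" by simp
  qed
  have gk_nonneg: "0 \<le> gk k x" if "k \<in> P" for k x
  proof -
    have "0 \<le> s (k i) (point1 (x i))" if "x \<in> cube d" "i \<in> {..<d}" for i
      using that cube[OF \<open>k \<in> P\<close>] by (intro s(2) point1_coordinate_in_cube) auto
    then show ?thesis
      unfolding gk_def tensor_product_def by (auto intro!: prod_nonneg)
  qed
  have gs: "gs \<in> V" "nrm gs \<le> t * H ^ d" "I d gs \<le> t * I 1 h ^ d"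
  proof -
    have "nrm gs \<le> (\<Sum>k\<in>P. nrm (gk k))" and "gs \<in> V"
      using banach_function_space_sum[OF V, of P gk] gk(1) by (auto simp: gs_def[abs_def])
    moreover have "(\<Sum>k\<in>P. nrm (gk k)) \<le> t * H ^ d"
      using sum_mono[of P "\<lambda>k. nrm (gk k)" "\<lambda>_. (H / c) ^ d"] gk(2)
      by (simp add: t_def power_divide)
    ultimately show "gs \<in> V" "nrm gs \<le> t * H ^ d" by auto
    have "I d gs = (\<Sum>k\<in>P. I d (gk k))"
      unfolding I_def gs_def using integrable' gk(1)
      by (intro Bochner_Integration.integral_sum) auto
    also have "\<dots> \<le> t * I 1 h ^ d"
      using sum_mono[of P "\<lambda>k. I d (gk k)" "\<lambda>_. (I 1 h / c) ^ d"] gk(3)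
      by (simp add: t_def power_divide)
    finally show "I d gs \<le> t * I 1 h ^ d" .
  qed
  have Q: "quadrature P a hp \<le> quadrature P a gs"
    unfolding quadrature_def
  proof (rule sum_mono)
    fix x assume x: "x \<in> P"
    \<comment> \<open>At the node \<open>x\<close> each factor is \<open>s y\<close> evaluated at
      its own \<open>y\<close>, where it equals \<open>h\<close>. The other summands of
      \<open>gs\<close> can only increase the value.\<close>
    have "hp x = gk x x"
      unfolding hp_def gk_def tensor_product_def using s(3) cube[OF x] by simp
    also have "\<dots> \<le> gs x"
      unfolding gs_def using member_le_sum[OF x, of "\<lambda>k. gk k x"] gk_nonneg P by simp
    finally show "a x * hp x \<le> a x * gs x"
      using a[OF x] by (rule mult_left_mono)
  qed

  \<comment> \<open>A common scaling brings \<open>hp\<close> and \<open>gs\<close> into the unit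
    ball and preserves the order of their quadrature values.\<close>
  define r where "r = 1 / H ^ d"
  have r: "r \<ge> 0" "\<bar>r\<bar> = r" "r * H ^ d = 1" using H by (auto simp: r_def)
  have "nrm gs \<le> H ^ d"
  proof (rule order_trans[OF gs(2)])
    show "t * H ^ d \<le> H ^ d"
      using mult_right_mono[OF t, of "H ^ d"] H by (simp del: mult_le_cancel_right2)
  qed
  then have "r * nrm hp \<le> 1" "r * nrm gs \<le> 1"
    using mult_left_mono[OF hp(2) r(1)] mult_left_mono[of "nrm gs" "H ^ d" r] r(1,3) by auto
  then have "ereal ((I d (\<lambda>x. r * hp x) - I d (\<lambda>x. r * gs x)) / 2)
      \<le> worst_case_error d V nrm P a"
    using scale[OF hp(1), of r] scale[OF gs(1), of r] r(2) mult_left_mono[OF Q r(1)]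
    by (intro worst_case_error_ge_half_diff) (simp_all add: scale_Q)
  moreover
  have "(I 1 h / H) ^ d * (1 - t) / 2
      \<le> (I d (\<lambda>x. r * hp x) - I d (\<lambda>x. r * gs x)) / 2"
  proof -
    have "(I 1 h / H) ^ d * (1 - t) = r * (I 1 h ^ d - t * I 1 h ^ d)"
      by (simp add: r_def power_divide algebra_simps diff_divide_distrib)
    also have "\<dots> \<le> r * (I d hp - I d gs)"
      by (rule mult_left_mono[OF _ r(1)]) (use gs(3) hp(3) in linarith)
    also have "\<dots> = I d (\<lambda>x. r * hp x) - I d (\<lambda>x. r * gs x)"
      by (simp only: scale_I right_diff_distrib)
    finally show ?thesis by (rule divide_right_mono) simp
  qed
  then have "ereal ((I 1 h / H) ^ d * (1 - t) / 2)
      \<le> ereal ((I d (\<lambda>x. r * hp x) - I d (\<lambda>x. r * gs x)) / 2)"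
    by (simp only: ereal_less_eq)
  ultimately show ?thesis
    unfolding H_def t_def by (rule order_trans[rotated])
qed

subsection \<open>Information complexity\<close>

lemma e_plus_le_e_qmc: "e_plus N d V nrm \<le> e_qmc N d V nrm"
  unfolding e_qmc_def e_plus_def
  by (rule INF_greatest, rule INF_lower2[of "(P, \<lambda>_. 1 / real N)" for P]) auto

text \<open>QMC weights are non-negative, so every \<open>N\<close> admissible for QMC is admissible
  here and the minimum runs over a larger set.\<close>

lemma N_int_plus_le_N_int_qmc: "N_int_plus F nrm \<epsilon> d \<le> N_int_qmc F nrm \<epsilon> d"
  unfolding N_int_plus_def N_int_qmc_def
  by (intro Inf_superset_mono image_mono) (auto intro: order_trans[OF e_plus_le_e_qmc])

text \<open>A bound valid for every admissible \<open>N\<close> passes to the minimum, which is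
  attained by well-ordering, or is infinite if no \<open>N\<close> is admissible.\<close>

lemma N_int_plus_ge:
  assumes "\<And>N. N \<ge> 1 \<Longrightarrow> e_plus N d (F d) (nrm d) \<le> ereal \<epsilon> * initial_error d (F d) (nrm d)
      \<Longrightarrow> r \<le> real N"
  shows "ereal r \<le> ereal_of_enat (N_int_plus F nrm \<epsilon> d)"
proof -
  let ?S = "{N. N \<ge> 1 \<and> e_plus N d (F d) (nrm d) \<le> ereal \<epsilon> * initial_error d (F d) (nrm d)}"
  show ?thesis
  proof (cases "?S = {}")
    case True
    then show ?thesis by (simp only: N_int_plus_def) (simp add: Inf_enat_def)
  next
    case False
    then have "Inf (enat ` ?S) \<in> enat ` ?S"
      by (auto intro: wellorder_InfI)
    then obtain N where "N \<in> ?S" "N_int_plus F nrm \<epsilon> d = enat N"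
      unfolding N_int_plus_def by auto
    then show ?thesis using assms by simp
  qed
qed

section \<open>From exponential lower bounds to the curse of dimensionality\<close>

lemma curse_of_dimensionality_mono:
  assumes "curse_of_dimensionality m" "\<And>\<epsilon> d. m \<epsilon> d \<le> n \<epsilon> d"
  shows "curse_of_dimensionality n"
proof -
  obtain \<epsilon> C' where e: "0 < \<epsilon>" "\<epsilon> < 1" "1 < C'"
    and inf: "infinite {d. d \<ge> 1 \<and> ereal_of_enat (m \<epsilon> d) \<ge> ereal (C' ^ d)}"
    using assms(1) unfolding curse_of_dimensionality_def by auto
  have "{d. d \<ge> 1 \<and> ereal_of_enat (m \<epsilon> d) \<ge> ereal (C' ^ d)}
      \<subseteq> {d. d \<ge> 1 \<and> ereal_of_enat (n \<epsilon> d) \<ge> ereal (C' ^ d)}"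
    using assms(2) by (auto intro: order_trans simp: ereal_of_enat_le_iff)
  with e inf show ?thesis
    unfolding curse_of_dimensionality_def by (meson infinite_super)
qed

text \<open>The definition of the curse allows no constant in front of the power. The factor
  \<delta> is absorbed by passing to the base \<open>sqrt c\<close>: once \<open>sqrt c ^ d\<close>
  exceeds \<open>1 / \<delta>\<close>, the other half of \<open>c ^ d\<close> remains.\<close>

lemma curse_of_dimensionalityI:
  fixes c \<epsilon> \<delta> :: real
  assumes "c > 1" "\<delta> > 0" "0 < \<epsilon>" "\<epsilon> < 1"
    and n: "\<And>d. d \<ge> 1 \<Longrightarrow> ereal (c ^ d * \<delta>) \<le> ereal_of_enat (n \<epsilon> d)"
  shows "curse_of_dimensionality n"
proof -
  have sqrt: "sqrt c > 1" "c = sqrt c * sqrt c" using assms(1) by auto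
  obtain D where D: "1 / \<delta> < sqrt c ^ D"
    using real_arch_pow[OF sqrt(1)] by blast
  have "{max D 1..} \<subseteq> {d. d \<ge> 1 \<and> ereal_of_enat (n \<epsilon> d) \<ge> ereal (sqrt c ^ d)}"
  proof
    fix d assume "d \<in> {max D 1..}"
    then have d: "d \<ge> D" "d \<ge> 1" by auto
    have "1 / \<delta> \<le> sqrt c ^ d"
      using D power_increasing[OF d(1), of "sqrt c"] sqrt(1) by linarith
    then have "1 \<le> sqrt c ^ d * \<delta>"
      using assms(2) by (simp add: field_simps)
    then have "sqrt c ^ d * 1 \<le> sqrt c ^ d * (sqrt c ^ d * \<delta>)"
      using assms(1) by (intro mult_left_mono) auto
    also have "\<dots> = c ^ d * \<delta>"
      by (subst sqrt(2)) (simp only: power_mult_distrib mult.assoc)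
    finally have "ereal (sqrt c ^ d) \<le> ereal (c ^ d * \<delta>)" by simp
    with n[OF d(2)] d(2) show "d \<in> {d. d \<ge> 1 \<and> ereal_of_enat (n \<epsilon> d) \<ge> ereal (sqrt c ^ d)}"
      by (metis (mono_tags, lifting) mem_Collect_eq order_trans)
  qed
  then have "infinite {d. d \<ge> 1 \<and> ereal_of_enat (n \<epsilon> d) \<ge> ereal (sqrt c ^ d)}"
    using infinite_Ici infinite_super by blast
  then show ?thesis
    unfolding curse_of_dimensionality_def using assms(3,4) sqrt(1) by blast
qed

text \<open>Turns the quotients under the infima into real bounds. For \<open>y = 0\<close> the
  conclusion is just non-negativity of \<open>x / c\<close>, so the convention for division by zero
  does no harm.\<close>

lemma le_divide_if_ereal_le_divide:
  fixes x y c :: real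
  assumes "ereal c \<le> ereal x / ereal y" "y \<ge> 0" "x \<ge> 0" "c > 0"
  shows "y \<le> x / c"
  using assms by (cases "y = 0") (auto simp: field_simps)

section \<open>Assembly of the lower bound and both curses\<close>

theorem theorem1:
  fixes F :: "nat \<Rightarrow> ((nat \<Rightarrow> real) \<Rightarrow> real) set"
    and nrm :: "nat \<Rightarrow> ((nat \<Rightarrow> real) \<Rightarrow> real) \<Rightarrow> real"
    and h :: "(nat \<Rightarrow> real) \<Rightarrow> real"
    and s :: "real \<Rightarrow> (nat \<Rightarrow> real) \<Rightarrow> real"
    and A B C :: ereal
  assumes banach: "\<And>d. d \<ge> 1 \<Longrightarrow> banach_function_space d (F d) (nrm d)"
    and tensor: "\<And>d f. d \<ge> 1 \<Longrightarrow> (\<And>i. i < d \<Longrightarrow> f i \<in> F 1) \<Longrightarrow>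
          tensor_product d f \<in> F d \<and> nrm d (tensor_product d f) \<le> (\<Prod>i<d. nrm 1 (f i))"
    and initial: "\<And>d. d \<ge> 1 \<Longrightarrow>
          initial_error d (F d) (nrm d) = initial_error 1 (F 1) (nrm 1) ^ d"
    and h: "h \<in> F 1" "\<And>x. x \<in> cube 1 \<Longrightarrow> h x \<ge> 0" "nrm 1 h \<noteq> 0" "I 1 h > 0"
    and h_extremal: "ereal (I 1 (\<lambda>x. h x / nrm 1 h)) = initial_error 1 (F 1) (nrm 1)"
    and s: "\<And>y. y \<in> {0..1} \<Longrightarrow> s y \<in> F 1"
      "\<And>y x. y \<in> {0..1} \<Longrightarrow> x \<in> cube 1 \<Longrightarrow> s y x \<ge> 0"
      "\<And>y. y \<in> {0..1} \<Longrightarrow> s y (point1 y) = h (point1 y)"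
    and A: "A = (INF y\<in>{0..1}. ereal (I 1 h) / ereal (I 1 (s y)))" "A > 1"
    and B: "B = (INF y\<in>{0..1}. ereal (nrm 1 h) / ereal (nrm 1 (s y)))" "B > 1"
    and C: "C = min A B"
  shows "C > 1
    \<and> (\<forall>d\<ge>1. \<forall>\<epsilon>. 0 < \<epsilon> \<and> \<epsilon> \<le> 1/2 \<longrightarrow>
          ereal_of_enat (N_int_plus F nrm \<epsilon> d) \<ge> C ^ d * ereal (1 - 2 * \<epsilon>))
    \<and> curse_of_dimensionality (N_int_plus F nrm)
    \<and> curse_of_dimensionality (N_int_qmc F nrm)"
proof -
  have V1: "banach_function_space 1 (F 1) (nrm 1)" by (rule banach) simp
  have nrm_nonneg: "nrm 1 f \<ge> 0" if "f \<in> F 1" for f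
    by (rule banach_function_spaceD(5)[OF V1 that])
  have H: "nrm 1 h > 0" using nrm_nonneg[OF h(1)] h(3) by simp
  have s_int_nonneg: "0 \<le> I 1 (s y)" if "y \<in> {0..1}" for y
    unfolding I_def
    by (rule Bochner_Integration.integral_nonneg) (use s(2)[OF that] in \<open>simp add: space_cube_measure\<close>)
  have C1: "C > 1" using A(2) B(2) C by simp

  \<comment> \<open>This makes \<open>C\<close> finite: an infinite \<open>B\<close> would force
    every \<open>s y\<close> to vanish, hence \<open>h = 0\<close> on the cube, against
    \<open>I 1 h > 0\<close>.\<close>
  have "\<exists>y\<in>{0..1}. nrm 1 (s y) \<noteq> 0"
  proof (rule ccontr)
    assume contr: "\<not> ?thesis"
    then have zero: "s y = (\<lambda>_. 0)" if "y \<in> {0..1}" for y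
      using banach_function_spaceD(6)[OF V1 s(1)[OF that]] that contr by blast
    have "h x = 0" if "x \<in> cube 1" for x
    proof -
      have "x 0 \<in> {0..1}" using that by (rule coordinate_in_unit_interval) simp
      then show ?thesis
        using s(3) zero point1_coordinate[OF that] by (metis (no_types))
    qed
    then have "I 1 h = I 1 (\<lambda>_. 0)"
      unfolding I_def by (intro Bochner_Integration.integral_cong) (auto simp: space_cube_measure)
    with h(4) show False by (simp add: I_def)
  qed
  then obtain y0 where y0: "y0 \<in> {0..1}" "nrm 1 (s y0) \<noteq> 0" by blast
  have "C \<le> ereal (nrm 1 h) / ereal (nrm 1 (s y0))"
    unfolding C B(1) by (rule min.coboundedI2) (rule INF_lower[OF y0(1)])
  then have "C \<noteq> \<infinity>" using y0(2) by auto
  with C1 obtain c where c: "C = ereal c" "c > 1"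
    by (cases C) auto
  have cA: "I 1 (s y) \<le> I 1 h / c" if y: "y \<in> {0..1}" for y
  proof (rule le_divide_if_ereal_le_divide)
    show "ereal c \<le> ereal (I 1 h) / ereal (I 1 (s y))"
      unfolding c(1)[symmetric] C A(1) by (rule min.coboundedI1) (rule INF_lower[OF y])
  qed (use s_int_nonneg[OF y] h(4) c(2) in auto)
  have cB: "nrm 1 (s y) \<le> nrm 1 h / c" if y: "y \<in> {0..1}" for y
  proof (rule le_divide_if_ereal_le_divide)
    show "ereal c \<le> ereal (nrm 1 h) / ereal (nrm 1 (s y))"
      unfolding c(1)[symmetric] C B(1) by (rule min.coboundedI2) (rule INF_lower[OF y])
  qed (use nrm_nonneg[OF s(1)[OF y]] H c(2) in auto)

  \<comment> \<open>By linearity of the integral and extremality of \<open>h\<close>, this is the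
    initial error for \<open>d = 1\<close>; all initial errors are thus finite and positive.\<close>
  define e0 where "e0 = I 1 h / nrm 1 h"
  have e0: "e0 > 0" using h(4) H by (simp add: e0_def)
  have "initial_error 1 (F 1) (nrm 1) = ereal e0"
    using h_extremal by (simp add: I_def e0_def)
  then have initial_eq: "initial_error d (F d) (nrm d) = ereal (e0 ^ d)" if "d \<ge> 1" for d
    using initial[OF that] by simp

  have e_plus_ge: "ereal (e0 ^ d * (1 - real N / c ^ d) / 2) \<le> e_plus N d (F d) (nrm d)"
    if d: "d \<ge> 1" for N d
    unfolding e_plus_def
  proof (rule INF_greatest, clarify)
    fix P and a :: "(nat \<Rightarrow> real) \<Rightarrow> real"
    assume P: "P \<subseteq> half_open_cube d" "finite P" "\<forall>x\<in>P. a x \<ge> 0" "N = card P"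
    show "ereal (e0 ^ d * (1 - real (card P) / c ^ d) / 2)
        \<le> worst_case_error d (F d) (nrm d) P a"
      unfolding e0_def
    proof (rule worst_case_error_lower_bound[where V = "F d" and nrm = "nrm d" and
          h = h and s = s and c = c and P = P and a = a,
          OF V1 banach[OF d] _ h(1) H _ s])
      show "tensor_product d f \<in> F d \<and>
          nrm d (tensor_product d f) \<le> (\<Prod>i<d. nrm 1 (f i))" if "\<And>i. i < d \<Longrightarrow> f i \<in> F 1" for f
        using d that by (rule tensor)
      show "P \<subseteq> cube d" using P(1) half_open_cube_subset by blast
      show "I 1 (s y) \<le> I 1 h / c" "nrm 1 (s y) \<le> nrm 1 h / c" if "y \<in> {0..1}" for y
        using that by (rule cA, rule cB)
    qed (use P h(4) c(2) in auto)
  qed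
  have main: "ereal (c ^ d * (1 - 2 * \<epsilon>)) \<le> ereal_of_enat (N_int_plus F nrm \<epsilon> d)"
    if d: "d \<ge> 1" for d \<epsilon>
  proof (rule N_int_plus_ge)
    fix N assume "e_plus N d (F d) (nrm d) \<le> ereal \<epsilon> * initial_error d (F d) (nrm d)"
    then have "ereal (e0 ^ d * (1 - real N / c ^ d) / 2) \<le> ereal (\<epsilon> * e0 ^ d)"
      using e_plus_ge[OF d, of N] by (auto simp only: initial_eq[OF d] times_ereal.simps intro: order_trans)
    \<comment> \<open>The 2 multiplying \<epsilon> is the factor 1/2 of the error bound moved
      across; the positive \<open>e0 ^ d\<close> then cancels.\<close>
    then have "e0 ^ d * (1 - real N / c ^ d) \<le> e0 ^ d * (2 * \<epsilon>)"
      by (simp add: mult_ac)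
    then have "1 - real N / c ^ d \<le> 2 * \<epsilon>"
      using e0 by simp
    then show "c ^ d * (1 - 2 * \<epsilon>) \<le> real N"
      using c(2) by (simp add: field_simps)
  qed
  \<comment> \<open>For \<epsilon> = 1/4 the factor \<open>1 - 2 * \<epsilon>\<close> is 1/2, which
    serves as \<delta>.\<close>
  have curse: "curse_of_dimensionality (N_int_plus F nrm)"
    by (rule curse_of_dimensionalityI[OF c(2), of "1/2" "1/4"]) (use main[of _ "1/4"] in auto)
  then have "curse_of_dimensionality (N_int_qmc F nrm)"
    using N_int_plus_le_N_int_qmc by (rule curse_of_dimensionality_mono)
  with C1 main curse show ?thesis
    by (simp add: c(1))
qed

end
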